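(* Let $I\subset R_0$ be an ideal. For all $d\in\mathbb{N}$, $$E_0^{d}[I:\langle x_1\rangle,\{x_1\}] = x_1\cdot E_0^{d+1}[I,\{x_1\}].$$
   Context: Let $R=\mathbb{C}[x_1,\dots,x_N]$, $\mathfrak m=\langle x_1,\dots,x_N\rangle$, $R_0=R_{\mathfrak m}$. For $\alpha\in(\mathbb{Z}_{\ge 0})^N$ let $\partial^\alpha:R_0\to\mathbb{C}$ be the functional $\partial^\alpha(g)=\left(\frac{1}{\alpha!}\frac{\partial^{|\alpha|}g}{\partial x^\alpha}\right)(0)$, with $\alpha!=\alpha_1!\cdots\alpha_N!$, $|\alpha|=\sum_i\alpha_i$. Let $D_0=\operatorname{span}_{\mathbb{C}}\{\partial^\alpha\}$ (finite linear combinations), and for an ideal $J\subset R_0$ let $D_0[J]=\{q\in D_0 : q(f)=0\text{ for all } f\in J\}$. The ring $R_0$ acts on $D_0$ by $(g\cdot q)(f)=q(gf)$; in particular $x_i\cdot\partial^\alpha=\partial^{\alpha-e_i}$ (zero if $\alpha_i=0$). For $A\subset\{x_1,\dots,x_N\}$, $\operatorname{ord}_A\partial^\alpha=\sum_{x_i\in A}\alpha_i$, and $\operatorname{ord}_A q$ is the maximum of $\operatorname{ord}_A$ over the terms of $q\in D_0$ occurring with nonzero coefficient (the zero functional satisfies every bound on $\operatorname{ord}_A$). The eliminating (truncated) dual space is $E_0^d[J,A]=\{q\in D_0[J] : \operatorname{ord}_A q\le d\}$. Also $I:\langle x_1\rangle=\{f\in R_0 : x_1f\in I\}$, and $x_1\cdot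 S=\{x_1\cdot q : q\in S\}$ for a subspace $S\subset D_0$. Here $\mathbb{N}=\mathbb{Z}_{\ge0}$. *)

theory Defs
  imports Complex_Main "HOL-Library.Poly_Mapping"
begin

section \<open>The polynomial ring\<close>

text \<open>
  The variables \<open>x\<^sub>1, \<dots>, x\<^sub>N\<close> are indexed, in order, by the elements of a finite linearly ordered
  type \<open>'n\<close>, where \<open>N = CARD('n)\<close>. Multi-indices are elements of \<open>'n \<Rightarrow>\<^sub>0 nat\<close>, and a polynomial maps
  each multi-index to its coefficient.
\<close>

abbreviation lookup :: "('a \<Rightarrow>\<^sub>0 'b::zero) \<Rightarrow> 'a \<Rightarrow> 'b" where
  "lookup \<equiv> Poly_Mapping.lookup"

abbreviation keys :: "('a \<Rightarrow>\<^sub>0 'b::zero) \<Rightarrow> 'a set" where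
  "keys \<equiv> Poly_Mapping.keys"

abbreviation single :: "'a \<Rightarrow> 'b::zero \<Rightarrow> 'a \<Rightarrow>\<^sub>0 'b" where
  "single \<equiv> Poly_Mapping.single"

type_synonym 'n mpoly = "('n \<Rightarrow>\<^sub>0 nat) \<Rightarrow>\<^sub>0 complex"

definition Var :: "'n \<Rightarrow> 'n mpoly" where
  "Var i = single (single i 1) 1"

text \<open>Truncated subtraction in the exponent is harmless: if \<open>\<alpha>\<^sub>i = 0\<close>, the coefficient vanishes.\<close>

definition mpoly_pderiv :: "'n \<Rightarrow> 'n mpoly \<Rightarrow> 'n mpoly" where
  "mpoly_pderiv i p =
     (\<Sum>\<alpha>\<in>keys p. single (\<alpha> - single i 1) (of_nat (lookup \<alpha> i) * lookup p \<alpha>))"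

text \<open>Evaluation at the origin yields the constant coefficient.\<close>

definition mpoly_at0 :: "'n mpoly \<Rightarrow> complex" where
  "mpoly_at0 p = lookup p 0"

text \<open>
  Ideals of a commutative ring are the submodules of the ring regarded as a module over itself;
  \<open>generated_ideal S\<close> is \<open>\<langle>S\<rangle>\<close>.
\<close>

abbreviation is_ideal :: "'a::comm_ring_1 set \<Rightarrow> bool" where
  "is_ideal \<equiv> module.subspace (*)"

abbreviation generated_ideal :: "'a::comm_ring_1 set \<Rightarrow> 'a set" where
  "generated_ideal \<equiv> module.span (*)"

lemma module_mult: "module ((*) :: 'a::comm_ring_1 \<Rightarrow> 'a \<Rightarrow> 'a)"
  by standard (auto simp: algebra_simps)

definition origin_ideal :: "'n mpoly set" where
  "origin_ideal = generated_ideal (range Var)"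

lemma mpoly_sum_monomials:
  fixes p :: "'n mpoly"
  shows "p = (\<Sum>\<alpha>\<in>keys p. single \<alpha> (lookup p \<alpha>))"
  by (rule poly_mapping_eqI)
     (auto simp: lookup_sum lookup_single when_def in_keys_iff)

lemma mpoly_induct [case_names monom add]:
  fixes p :: "'n mpoly"
  assumes m: "\<And>\<alpha> c. P (single \<alpha> c)" and a: "\<And>p q. P p \<Longrightarrow> P q \<Longrightarrow> P (p + q)"
  shows "P p"
proof -
  have "P (\<Sum>\<alpha>\<in>A. single \<alpha> (lookup p \<alpha>))" if "finite A" for A
    using that
  proof induction
    case empty
    then show ?case using m[of 0 0] by simp
  qed (simp add: m a)
  then show ?thesis using mpoly_sum_monomials[of p] by (metis finite_keys)
qed

lemma multi_index_pos_decomp: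
  fixes \<alpha> :: "'n \<Rightarrow>\<^sub>0 nat"
  assumes "0 < lookup \<alpha> i"
  shows "\<alpha> = \<alpha> - single i 1 + single i 1"
  using assms
  by (intro poly_mapping_eqI) (auto simp: lookup_add lookup_minus lookup_single when_def)

lemma lookup_mpoly_pderiv:
  "lookup (mpoly_pderiv i p) \<gamma> =
     of_nat (lookup \<gamma> i + 1) * lookup p (\<gamma> + single i 1)"
proof -
  let ?e = "single i (1::nat)"
  have eq: "(if \<alpha> - ?e = \<gamma> then of_nat (lookup \<alpha> i) * lookup p \<alpha> else 0) =
      (if \<alpha> = \<gamma> + ?e then of_nat (lookup \<gamma> i + 1) * lookup p (\<gamma> + ?e) else 0)" for \<alpha>
  proof (cases "lookup \<alpha> i = 0")
    case True
    then have "\<alpha> \<noteq> \<gamma> + ?e" by (auto simp: lookup_add)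
    with True show ?thesis by simp
  next
    case False
    then show ?thesis
      using multi_index_pos_decomp[of \<alpha> i] by (auto simp: lookup_add)
  qed
  have "lookup (mpoly_pderiv i p) \<gamma> =
      (\<Sum>\<alpha>\<in>keys p. if \<alpha> - ?e = \<gamma> then of_nat (lookup \<alpha> i) * lookup p \<alpha> else 0)"
    by (simp add: mpoly_pderiv_def lookup_sum lookup_single when_def)
  also have "\<dots> = (\<Sum>\<alpha>\<in>keys p. if \<alpha> = \<gamma> + ?e then of_nat (lookup \<gamma> i + 1) * lookup p (\<gamma> + ?e) else 0)"
    by (simp only: eq)
  also have "\<dots> = of_nat (lookup \<gamma> i + 1) * lookup p (\<gamma> + ?e)"
    by (auto simp: in_keys_iff)
  finally show ?thesis .
qed

lemma mpoly_pderiv_add: "mpoly_pderiv i (p + q) = mpoly_pderiv i p + mpoly_pderiv i q"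
  by (rule poly_mapping_eqI) (simp add: lookup_mpoly_pderiv lookup_add algebra_simps)

lemma mpoly_pderiv_single:
  "mpoly_pderiv i (single \<alpha> c) =
     single (\<alpha> - single i 1) (of_nat (lookup \<alpha> i) * c)"
  by (cases "c = 0") (auto simp: mpoly_pderiv_def)

lemma mpoly_pderiv_mult:
  "mpoly_pderiv i (p * q) = mpoly_pderiv i p * q + p * mpoly_pderiv i q"
proof (induction p rule: mpoly_induct)
  case (monom \<alpha> c)
  show ?case
  proof (induction q rule: mpoly_induct)
    case (monom \<beta> d)
    let ?e = "single i (1::nat)"
    have 1: "\<alpha> + \<beta> - ?e = (\<alpha> - ?e) + \<beta>" if "lookup \<alpha> i \<noteq> 0"
      using that by (intro poly_mapping_eqI) (auto simp: lookup_add lookup_minus lookup_single when_def)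
    have 2: "\<alpha> + \<beta> - ?e = \<alpha> + (\<beta> - ?e)" if "lookup \<beta> i \<noteq> 0"
      using that by (intro poly_mapping_eqI) (auto simp: lookup_add lookup_minus lookup_single when_def)
    have "single (\<alpha> + \<beta> - ?e) (of_nat (lookup \<alpha> i) * (c * d)) =
        single ((\<alpha> - ?e) + \<beta>) (of_nat (lookup \<alpha> i) * c * d)"
      using 1 by (cases "lookup \<alpha> i = 0") (auto simp: mult.assoc)
    moreover have "single (\<alpha> + \<beta> - ?e) (of_nat (lookup \<beta> i) * (c * d)) =
        single (\<alpha> + (\<beta> - ?e)) (c * (of_nat (lookup \<beta> i) * d))"
      using 2 by (cases "lookup \<beta> i = 0") (auto simp: algebra_simps)
    ultimately show ?case
      by (simp add: mpoly_pderiv_single mult_single lookup_add distrib_right single_add)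
  next
    case (add p q)
    then show ?case by (simp add: mpoly_pderiv_add algebra_simps)
  qed
next
  case (add p q)
  then show ?case by (simp add: mpoly_pderiv_add algebra_simps)
qed

lemma mpoly_at0_add [simp]: "mpoly_at0 (p + q) = mpoly_at0 p + mpoly_at0 q"
  by (simp add: mpoly_at0_def lookup_add)

lemma mpoly_at0_zero [simp]: "mpoly_at0 0 = 0"
  by (simp add: mpoly_at0_def)

lemma mpoly_at0_one [simp]: "mpoly_at0 1 = 1"
  by (simp add: mpoly_at0_def)

lemma multi_index_add_eq_0: "\<alpha> + \<beta> = 0 \<longleftrightarrow> \<alpha> = 0 \<and> \<beta> = 0" for \<alpha> \<beta> :: "'n \<Rightarrow>\<^sub>0 nat"
  by (auto simp: poly_mapping_eq_iff lookup_add fun_eq_iff)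

lemma mpoly_at0_mult [simp]: "mpoly_at0 (p * q) = mpoly_at0 p * mpoly_at0 q"
proof (induction p rule: mpoly_induct)
  case (monom \<alpha> c)
  show ?case
  proof (induction q rule: mpoly_induct)
    case (monom \<beta> d)
    then show ?case
      by (auto simp: mpoly_at0_def mult_single lookup_single when_def multi_index_add_eq_0)
  qed (simp add: algebra_simps)
qed (simp add: algebra_simps)

lemma mpoly_at0_Var [simp]: "mpoly_at0 (Var i) = 0"
proof -
  have "single i (1::nat) \<noteq> 0"
    by (metis lookup_single_eq lookup_zero zero_neq_one)
  then show ?thesis
    by (simp add: mpoly_at0_def Var_def lookup_single when_def)
qed

lemma origin_ideal_iff: "p \<in> origin_ideal \<longleftrightarrow> mpoly_at0 p = 0"
proof
  assume "p \<in> origin_ideal"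
  then show "mpoly_at0 p = 0"
    unfolding origin_ideal_def
  proof (induction rule: module.span_induct_alt[OF module_mult, consumes 1])
    case (2 c x y)
    then show ?case
      by auto
  qed simp
next
  assume p0: "mpoly_at0 p = 0"
  have "single \<alpha> (lookup p \<alpha>) \<in> origin_ideal" for \<alpha>
  proof (cases "\<alpha> = 0")
    case True
    then show ?thesis using p0
      by (simp add: mpoly_at0_def origin_ideal_def module.span_zero[OF module_mult])
  next
    case False
    then obtain i where "0 < lookup \<alpha> i"
      by (auto simp: poly_mapping_eq_iff fun_eq_iff)
    then have "single \<alpha> (lookup p \<alpha>) =
        single (\<alpha> - single i 1) (lookup p \<alpha>) * Var i"
      by (simp add: Var_def mult_single multi_index_pos_decomp[symmetric, simplified])
    then show ?thesis
      by (simp add: origin_ideal_def module.span_scale[OF module_mult] module.span_base[OF module_mult])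
  qed
  then have "(\<Sum>\<alpha>\<in>keys p. single \<alpha> (lookup p \<alpha>)) \<in> origin_ideal"
    by (simp add: origin_ideal_def module.span_sum[OF module_mult])
  then show "p \<in> origin_ideal"
    using mpoly_sum_monomials[of p] by simp
qed

section \<open>The local ring at the origin\<close>

lifting_forget poly_mapping.lifting

text \<open>
  Two fractions \<open>p / q\<close> and \<open>r / s\<close> with denominators outside the maximal ideal are identified iff
  \<open>p s = r q\<close>; no further multiplier is needed, as the polynomial ring is a domain.
\<close>

definition local_rel :: "'n mpoly \<times> 'n mpoly \<Rightarrow> 'n mpoly \<times> 'n mpoly \<Rightarrow> bool" where
  "local_rel x y \<longleftrightarrow>
     snd x \<notin> origin_ideal \<and> snd y \<notin> origin_ideal \<and> fst x * snd y = fst y * snd x"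

quotient_type (overloaded) 'n local_ring =
  "'n::{finite,linorder} mpoly \<times> 'n mpoly" / partial: local_rel
proof (rule part_equivpI)
  show "\<exists>x. local_rel x (x :: 'n mpoly \<times> 'n mpoly)"
    by (rule exI[of _ "(0, 1)"]) (simp add: local_rel_def origin_ideal_iff)
  show "symp (local_rel :: 'n mpoly \<times> 'n mpoly \<Rightarrow> _)"
    by (auto simp: symp_def local_rel_def)
  show "transp (local_rel :: 'n mpoly \<times> 'n mpoly \<Rightarrow> _)"
  proof (rule transpI)
    fix x y z :: "'n mpoly \<times> 'n mpoly"
    assume xy: "local_rel x y" and yz: "local_rel y z"
    have "snd y * (fst x * snd z) = snd z * (fst x * snd y)" by (simp add: ac_simps)
    also have "\<dots> = snd x * (fst y * snd z)" using xy by (simp add: local_rel_def ac_simps)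
    also have "\<dots> = snd y * (fst z * snd x)" using yz by (simp add: local_rel_def ac_simps)
    finally have "snd y * (fst x * snd z) = snd y * (fst z * snd x)" .
    moreover have "snd y \<noteq> 0" using xy by (auto simp: local_rel_def origin_ideal_iff)
    ultimately show "local_rel x z" using xy yz by (simp add: local_rel_def)
  qed
qed

lift_definition frac :: "'n::{finite,linorder} mpoly \<Rightarrow> 'n mpoly \<Rightarrow> 'n local_ring" is
  "\<lambda>p q. if q \<in> origin_ideal then (0, 1) else (p, q)"
  by (simp add: local_rel_def origin_ideal_iff)

lemma frac_cases [cases type: local_ring]:
  obtains (frac) p q where "f = frac p q" "q \<notin> origin_ideal"
  by transfer (auto simp: local_rel_def)

lemma frac_eq_iff:
  "q \<notin> origin_ideal \<Longrightarrow> s \<notin> origin_ideal \<Longrightarrow> frac p q = frac r s \<longleftrightarrow> p * s = r * q"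
  by transfer (simp add: local_rel_def)

instantiation local_ring :: ("{finite,linorder}") comm_ring_1
begin

lift_definition zero_local_ring :: "'a local_ring" is "(0, 1)"
  by (simp add: local_rel_def origin_ideal_iff)

lift_definition one_local_ring :: "'a local_ring" is "(1, 1)"
  by (simp add: local_rel_def origin_ideal_iff)

lift_definition plus_local_ring :: "'a local_ring \<Rightarrow> 'a local_ring \<Rightarrow> 'a local_ring" is
  "\<lambda>x y. (fst x * snd y + fst y * snd x, snd x * snd y)"
proof (clarsimp simp: local_rel_def origin_ideal_iff)
  fix p q r s p' q' r' s' :: "'a mpoly"
  assume "p * s = r * q" "p' * s' = r' * q'"
  then show "(p * q' + p' * q) * (s * s') = (r * s' + r' * s) * (q * q')"
    by algebra
qed

lift_definition uminus_local_ring :: "'a local_ring \<Rightarrow> 'a local_ring" is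
  "\<lambda>x. (- fst x, snd x)"
  by (simp add: local_rel_def)

lift_definition times_local_ring :: "'a local_ring \<Rightarrow> 'a local_ring \<Rightarrow> 'a local_ring" is
  "\<lambda>x y. (fst x * fst y, snd x * snd y)"
proof (clarsimp simp: local_rel_def origin_ideal_iff)
  fix p q r s p' q' r' s' :: "'a mpoly"
  assume "p * s = r * q" "p' * s' = r' * q'"
  then show "p * p' * (s * s') = r * r' * (q * q')"
    by algebra
qed

definition minus_local_ring :: "'a local_ring \<Rightarrow> 'a local_ring \<Rightarrow> 'a local_ring" where
  "f - g = f + - (g :: 'a local_ring)"

instance
  by standard
     (simp add: minus_local_ring_def |
       (transfer, simp add: local_rel_def origin_ideal_iff algebra_simps))+

end

lift_definition pderiv :: "'n::{finite,linorder} \<Rightarrow> 'n local_ring \<Rightarrow> 'n local_ring" is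
  "\<lambda>i (p, q). (mpoly_pderiv i p * q - p * mpoly_pderiv i q, q * q)"
proof (clarsimp simp: local_rel_def origin_ideal_iff)
  fix i :: 'n and p q r s :: "'n mpoly"
  assume eq: "p * s = r * q"
  have "mpoly_pderiv i p * s + p * mpoly_pderiv i s = mpoly_pderiv i r * q + r * mpoly_pderiv i q"
    using arg_cong[OF eq, of "mpoly_pderiv i"] by (simp add: mpoly_pderiv_mult)
  with eq show "(mpoly_pderiv i p * q - p * mpoly_pderiv i q) * (s * s) =
      (mpoly_pderiv i r * s - r * mpoly_pderiv i s) * (q * q)"
    by algebra
qed

lift_definition at0 :: "'n::{finite,linorder} local_ring \<Rightarrow> complex" is
  "\<lambda>(p, q). mpoly_at0 p / mpoly_at0 q"
  by (auto simp: local_rel_def origin_ideal_iff field_simps simp flip: mpoly_at0_mult)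

text \<open>\<open>\<partial>\<^bsup>|\<alpha>|\<^esup>g / \<partial>x\<^sup>\<alpha>\<close>, applying the partial derivatives one variable after the other.\<close>

definition mixed_pderiv :: "('n::{finite,linorder} \<Rightarrow>\<^sub>0 nat) \<Rightarrow> 'n local_ring \<Rightarrow> 'n local_ring" where
  "mixed_pderiv \<alpha> = foldr (\<lambda>i. pderiv i ^^ lookup \<alpha> i) (sorted_list_of_set UNIV)"

definition coord :: "'n::{finite,linorder} \<Rightarrow> 'n local_ring" where
  "coord i = frac (Var i) 1"

definition colon :: "'a::comm_ring_1 set \<Rightarrow> 'a \<Rightarrow> 'a set" where
  "colon I g = {f. g * f \<in> I}"

section \<open>The dual space at the origin\<close>

definition dpoint :: "('n::{finite,linorder} \<Rightarrow>\<^sub>0 nat) \<Rightarrow> 'n local_ring \<Rightarrow> complex" where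
  "dpoint \<alpha> g = at0 (mixed_pderiv \<alpha> g) / of_nat (\<Prod>i\<in>UNIV. fact (lookup \<alpha> i))"

text \<open>The finite linear combination of the \<open>\<partial>\<^sup>\<alpha>\<close> with prescribed coefficients.\<close>

definition dcomb :: "(('n::{finite,linorder} \<Rightarrow>\<^sub>0 nat) \<Rightarrow>\<^sub>0 complex) \<Rightarrow> 'n local_ring \<Rightarrow> complex" where
  "dcomb c g = (\<Sum>\<alpha>\<in>keys c. lookup c \<alpha> * dpoint \<alpha> g)"

definition D\<^sub>0 :: "('n::{finite,linorder} local_ring \<Rightarrow> complex) set" where
  "D\<^sub>0 = range dcomb"

definition dual_space :: "'n::{finite,linorder} local_ring set \<Rightarrow> ('n local_ring \<Rightarrow> complex) set" where
  "dual_space J = {q \<in> D\<^sub>0. \<forall>f\<in>J. q f = 0}"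

definition act :: "'n::{finite,linorder} local_ring \<Rightarrow> ('n local_ring \<Rightarrow> complex) \<Rightarrow> 'n local_ring \<Rightarrow> complex" where
  "act g q = (\<lambda>f. q (g * f))"

text \<open>
  The multi-indices of the terms occurring in \<open>q \<in> D\<^sub>0\<close> with nonzero coefficient. The coefficients are
  unique by the linear independence of the \<open>\<partial>\<^sup>\<alpha>\<close>, see lemma \<open>inj_dcomb\<close> below.
\<close>

definition terms :: "('n::{finite,linorder} local_ring \<Rightarrow> complex) \<Rightarrow> ('n \<Rightarrow>\<^sub>0 nat) set" where
  "terms q = keys (THE c. q = dcomb c)"

text \<open>
  A set of variables is given by the set of their indices. Inserting \<open>0\<close> affects only the zero
  functional, which thereby satisfies every bound on its order.
\<close>

definition ord :: "'n::{finite,linorder} set \<Rightarrow> ('n local_ring \<Rightarrow> complex) \<Rightarrow> nat" where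
  "ord A q = Max (insert 0 ((\<lambda>\<alpha>. \<Sum>i\<in>A. lookup \<alpha> i) ` terms q))"

definition elim_dual_space ::
  "nat \<Rightarrow> 'n::{finite,linorder} local_ring set \<Rightarrow> 'n set \<Rightarrow> ('n local_ring \<Rightarrow> complex) set" where
  "elim_dual_space d J A = {q \<in> dual_space J. ord A q \<le> d}"

text \<open>The index of \<open>x\<^sub>1\<close>.\<close>

definition first_index :: "'n::{finite,linorder}" where
  "first_index = Min UNIV"

subsection \<open>Linear independence of the differential functionals\<close>

lemma mpoly_pderiv_one [simp]: "mpoly_pderiv i 1 = 0"
  using mpoly_pderiv_single[of i 0 1] by simp

lemma frac_one_pderiv: "pderiv i (frac p 1) = frac (mpoly_pderiv i p) 1"
  by transfer (simp add: local_rel_def origin_ideal_iff)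

lemma at0_frac_one: "at0 (frac p 1) = mpoly_at0 p"
  by transfer (simp add: origin_ideal_iff)

lemma frac_one_pderiv_pow: "(pderiv i ^^ k) (frac p 1) = frac ((mpoly_pderiv i ^^ k) p) 1"
  by (induction k) (simp_all add: frac_one_pderiv)

lemma lookup_mpoly_pderiv_pow:
  "lookup ((mpoly_pderiv i ^^ k) p) \<gamma> =
     pochhammer (of_nat (lookup \<gamma> i + 1)) k * lookup p (\<gamma> + single i k)"
proof (induction k arbitrary: \<gamma>)
  case (Suc k)
  have "\<gamma> + single i 1 + single i k = \<gamma> + single i (Suc k)"
    by (simp add: add.assoc flip: single_add)
  then show ?case
    by (simp add: lookup_mpoly_pderiv Suc lookup_add pochhammer_rec add_ac)
qed simp

lemma mixed_pderiv_frac_one: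
  assumes "distinct xs"
  shows "\<exists>r. foldr (\<lambda>i. pderiv i ^^ lookup \<alpha> i) xs (frac p 1) = frac r 1 \<and>
    (\<forall>\<gamma>. lookup r \<gamma> = (\<Prod>i\<in>set xs. pochhammer (of_nat (lookup \<gamma> i + 1)) (lookup \<alpha> i)) *
       lookup p (\<gamma> + (\<Sum>i\<in>set xs. single i (lookup \<alpha> i))))"
  using assms
proof (induction xs)
  case Nil
  then show ?case by (intro exI[of _ p]) simp
next
  case (Cons j xs)
  then obtain r where r: "foldr (\<lambda>i. pderiv i ^^ lookup \<alpha> i) xs (frac p 1) = frac r 1"
    "\<And>\<gamma>. lookup r \<gamma> = (\<Prod>i\<in>set xs. pochhammer (of_nat (lookup \<gamma> i + 1)) (lookup \<alpha> i)) *
       lookup p (\<gamma> + (\<Sum>i\<in>set xs. single i (lookup \<alpha> i)))"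
    by auto
  have "(\<Prod>i\<in>set xs. pochhammer (of_nat (lookup (\<gamma> + single j k) i + 1) :: complex) (lookup \<alpha> i)) =
      (\<Prod>i\<in>set xs. pochhammer (of_nat (lookup \<gamma> i + 1)) (lookup \<alpha> i))" for \<gamma> k
    using Cons.prems by (intro prod.cong) (auto simp: lookup_add lookup_single when_def)
  then show ?case
    using Cons.prems
    by (intro exI[of _ "(mpoly_pderiv j ^^ lookup \<alpha> j) r"])
       (simp add: r frac_one_pderiv_pow lookup_mpoly_pderiv_pow add.assoc mult.assoc)
qed

lemma dpoint_frac_one: "dpoint \<alpha> (frac p 1) = lookup p \<alpha>"
proof -
  have \<alpha>: "(\<Sum>i\<in>UNIV. single i (lookup \<alpha> i)) = \<alpha>"
    by (rule poly_mapping_eqI) (simp add: lookup_sum lookup_single when_def)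
  have "at0 (mixed_pderiv \<alpha> (frac p 1)) = (\<Prod>i\<in>UNIV. fact (lookup \<alpha> i)) * lookup p \<alpha>"
    using mixed_pderiv_frac_one[of "sorted_list_of_set UNIV" \<alpha> p]
    by (auto simp: mixed_pderiv_def at0_frac_one mpoly_at0_def \<alpha> simp flip: pochhammer_fact)
  moreover have "(\<Prod>i\<in>UNIV. fact (lookup \<alpha> i) :: complex) \<noteq> 0"
    by simp
  ultimately show ?thesis
    by (simp add: dpoint_def)
qed

lemma inj_dcomb: "inj dcomb"
proof (rule injI)
  fix c d :: "('n::{finite,linorder} \<Rightarrow>\<^sub>0 nat) \<Rightarrow>\<^sub>0 complex"
  assume eq: "dcomb c = dcomb d"
  have "dcomb c (frac (single \<beta> 1) 1) = lookup c \<beta>"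
    for c :: "('n \<Rightarrow>\<^sub>0 nat) \<Rightarrow>\<^sub>0 complex" and \<beta>
    by (auto simp: dcomb_def dpoint_frac_one lookup_single when_def if_distrib in_keys_iff cong: if_cong)
  then show "c = d"
    using eq by (intro poly_mapping_eqI) metis
qed

lemma terms_dcomb: "terms (dcomb c) = keys c"
proof -
  have "(THE c'. dcomb c = dcomb c') = c"
    using inj_dcomb by (intro the_equality) (auto dest: injD)
  then show ?thesis by (simp add: terms_def)
qed

end

theory Submission
  imports Defs
begin

text \<open>
  Let \<open>q = \<Sum> c\<^sub>\<alpha> \<partial>\<^sup>\<alpha>\<close> annihilate \<open>I : \<langle>x\<^sub>1\<rangle>\<close>. A preimage of \<open>q\<close> under the action of \<open>x\<^sub>1\<close> that lies in the
  dual space of \<open>I\<close> is a functional \<open>\<phi>\<close> with \<open>\<phi>(x\<^sub>1 p) = q(p)\<close> that vanishes on \<open>I\<close> and on some power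
  \<open>\<mm>\<^sup>n\<close> of the maximal ideal. By linear algebra it exists as soon as \<open>x\<^sub>1 p \<in> I + \<mm>\<^sup>n\<close> implies
  \<open>q(p) = 0\<close>. As \<open>q\<close> vanishes on some \<open>\<mm>\<^sup>k\<close>, it suffices that \<open>x\<^sub>1 p \<in> I + \<mm>\<^sup>n\<close> implies
  \<open>p \<in> (I : \<langle>x\<^sub>1\<rangle>) + \<mm>\<^sup>k\<close>, which for large \<open>n\<close> is the Artin--Rees property of \<open>I + \<langle>x\<^sub>1\<rangle>\<close>. The latter
  can be proved in the polynomial ring, by Dickson's lemma applied to the leading monomials in the
  extended Rees algebra. The bound on the order comes for free: \<open>x\<^sub>1\<close> maps the terms \<open>\<partial>\<^sup>\<alpha>\<close> with
  \<open>\<alpha>\<^sub>1 > 0\<close> injectively to terms, lowering \<open>\<alpha>\<^sub>1\<close> by one.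
\<close>

section \<open>The Artin--Rees property\<close>

text \<open>A monotone subsequence exists. If it decreases, it is constant once its minimum is
  reached, so a tail of it is nondecreasing.\<close>

lemma nat_mono_subseq:
  fixes f :: "nat \<Rightarrow> nat"
  shows "\<exists>s :: nat \<Rightarrow> nat. strict_mono s \<and> mono (f \<circ> s)"
proof -
  obtain s :: "nat \<Rightarrow> nat" where s: "strict_mono s" "monoseq (\<lambda>n. f (s n))"
    using seq_monosub[of f] by blast
  show ?thesis
  proof (cases "incseq (\<lambda>n. f (s n))")
    case True
    with s show ?thesis unfolding o_def by blast
  next
    case False
    then have dec: "decseq (\<lambda>n. f (s n))"
      using s(2) by (auto simp: monoseq_iff)
    define m where "m = (LEAST v. v \<in> range (\<lambda>n. f (s n)))"
    have "m \<in> range (\<lambda>n. f (s n))"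
      unfolding m_def by (rule LeastI[of _ "f (s 0)"]) auto
    then obtain n0 where n0: "m = f (s n0)" by auto
    have "f (s n) = m" if "n \<ge> n0" for n
    proof (rule antisym)
      show "f (s n) \<le> m" using decseqD[OF dec that] by (simp add: n0)
      show "m \<le> f (s n)" unfolding m_def by (rule Least_le) auto
    qed
    then have "mono (f \<circ> (\<lambda>n. s (n0 + n)))"
      by (auto simp: mono_def)
    moreover have "strict_mono (\<lambda>n. s (n0 + n))"
      using s(1) by (auto simp: strict_mono_def)
    ultimately show ?thesis by blast
  qed
qed

text \<open>Thin out for one coordinate after another: a further subsequence keeps the coordinates
  already treated monotone.\<close>

lemma dickson_subseq:
  fixes f :: "'i \<Rightarrow> nat \<Rightarrow> nat"
  assumes "finite A"
  shows "\<exists>s :: nat \<Rightarrow> nat. strict_mono s \<and> (\<forall>i\<in>A. mono (f i \<circ> s))"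
  using assms
proof induction
  case empty
  then show ?case by (intro exI[of _ "\<lambda>n. n"]) (simp add: strict_mono_def)
next
  case (insert j A)
  then obtain s :: "nat \<Rightarrow> nat" where s: "strict_mono s" "\<forall>i\<in>A. mono (f i \<circ> s)" by blast
  obtain t :: "nat \<Rightarrow> nat" where t: "strict_mono t" "mono ((f j \<circ> s) \<circ> t)"
    using nat_mono_subseq by blast
  have "strict_mono (s \<circ> t)" using s t by (simp add: strict_mono_o)
  moreover have "\<forall>i\<in>insert j A. mono (f i \<circ> (s \<circ> t))"
    using s(2) t strict_mono_mono[OF t(1)] by (auto simp: mono_def)
  ultimately show ?case by blast
qed

section \<open>Divisibility and the lexicographic order of multi-indices\<close>

definition index_dvd :: "('n \<Rightarrow>\<^sub>0 nat) \<Rightarrow> ('n \<Rightarrow>\<^sub>0 nat) \<Rightarrow> bool" where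
  "index_dvd \<alpha> \<beta> \<longleftrightarrow> (\<forall>i. lookup \<alpha> i \<le> lookup \<beta> i)"

lemma index_dvd_diff_add: "index_dvd \<alpha> \<beta> \<Longrightarrow> \<beta> - \<alpha> + \<alpha> = \<beta>"
  by (intro poly_mapping_eqI) (simp add: index_dvd_def lookup_add lookup_minus)

lemma index_nonneg: "0 \<le> (\<alpha> :: 'n::linorder \<Rightarrow>\<^sub>0 nat)"
proof -
  have "\<not> \<alpha> < 0"
    by (simp add: less_poly_mapping.rep_eq less_fun_def)
  then show ?thesis by simp
qed

lemma index_dvd_imp_le: "index_dvd \<alpha> \<beta> \<Longrightarrow> \<alpha> \<le> (\<beta> :: 'n::linorder \<Rightarrow>\<^sub>0 nat)"
  using add_right_mono[OF index_nonneg[of "\<beta> - \<alpha>"], of \<alpha>] index_dvd_diff_add[of \<alpha> \<beta>] by simp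

text \<open>Dickson's lemma finds in a descending chain an earlier member dividing a later one,
  hence lexicographically at most it.\<close>

lemma wf_index: "wf {(\<alpha>, \<beta> :: 'n::{finite,linorder} \<Rightarrow>\<^sub>0 nat). \<alpha> < \<beta>}"
  unfolding wf_iff_no_infinite_down_chain
proof
  assume "\<exists>g. \<forall>k. (g (Suc k), g k) \<in> {(\<alpha>, \<beta> :: 'n \<Rightarrow>\<^sub>0 nat). \<alpha> < \<beta>}"
  then obtain g :: "nat \<Rightarrow> 'n \<Rightarrow>\<^sub>0 nat" where g: "\<And>k. g (Suc k) < g k" by auto
  obtain s :: "nat \<Rightarrow> nat" where s: "strict_mono s" "\<And>i. mono ((\<lambda>n. lookup (g n) i) \<circ> s)"
    using dickson_subseq[of "UNIV :: 'n set" "\<lambda>i n. lookup (g n) i"] by auto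
  have "index_dvd (g (s 0)) (g (s 1))"
    using s(2) by (auto simp: index_dvd_def mono_def)
  then have "g (s 0) \<le> g (s 1)" by (rule index_dvd_imp_le)
  moreover have "g (s 1) < g (s 0)"
  proof -
    have "decseq g" using g by (intro decseq_SucI less_imp_le)
    moreover have "Suc (s 0) \<le> s 1"
      using s(1) by (simp add: strict_mono_def Suc_le_eq)
    ultimately have "g (s 1) \<le> g (Suc (s 0))" by (rule decseqD)
    with g show ?thesis by (rule le_less_trans[rotated])
  qed
  ultimately show False by simp
qed

section \<open>The filtration by order\<close>

definition index_degree :: "('n::finite \<Rightarrow>\<^sub>0 nat) \<Rightarrow> nat" where
  "index_degree \<alpha> = (\<Sum>i\<in>UNIV. lookup \<alpha> i)"

lemma index_degree_add: "index_degree (\<alpha> + \<beta>) = index_degree \<alpha> + index_degree \<beta>"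
  by (simp add: index_degree_def lookup_add sum.distrib)

text \<open>The \<open>n\<close>-th power of the maximal ideal, described by the orders of the monomials.\<close>

definition order_ge :: "nat \<Rightarrow> 'n::finite mpoly set" where
  "order_ge n = {p. \<forall>\<alpha>\<in>keys p. n \<le> index_degree \<alpha>}"

lemma order_ge_zero: "0 \<in> order_ge n"
  by (simp add: order_ge_def)

lemma order_ge_add: "p \<in> order_ge n \<Longrightarrow> q \<in> order_ge n \<Longrightarrow> p + q \<in> order_ge n"
  using keys_add[of p q] by (auto simp: order_ge_def)

lemma order_ge_mult: "p \<in> order_ge m \<Longrightarrow> q \<in> order_ge n \<Longrightarrow> p * q \<in> order_ge (m + n)"
  using keys_mult[of p q] by (fastforce simp: order_ge_def index_degree_add add_mono)

lemma order_ge_antimono: "m \<le> n \<Longrightarrow> order_ge n \<subseteq> order_ge m"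
  by (force simp: order_ge_def)

lemma order_ge_mult_left: "q \<in> order_ge n \<Longrightarrow> p * q \<in> order_ge n"
  using order_ge_mult[of p 0 q n] by (simp add: order_ge_def)

lemma order_ge_diff: "p \<in> order_ge n \<Longrightarrow> q \<in> order_ge n \<Longrightarrow> p - q \<in> order_ge n"
  using order_ge_add[of p n "-q"] by (simp add: order_ge_def)

lemma single_in_order_ge: "n \<le> index_degree \<alpha> \<Longrightarrow> single \<alpha> c \<in> order_ge n"
  by (simp add: order_ge_def)

section \<open>Leading monomials, reduction and the Artin--Rees bound\<close>

lemma lookup_single_mult:
  fixes g :: "'n mpoly"
  shows "lookup (single \<beta> c * g) (\<beta> + \<gamma>) = c * lookup g \<gamma>"
proof (induction g rule: mpoly_induct)
  case (monom \<alpha> d)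
  then show ?case by (simp add: mult_single lookup_single when_def)
qed (simp add: distrib_left lookup_add)

text \<open>The maximum is lexicographic. For the zero polynomial it is unspecified, so that zero is
  treated apart below.\<close>

definition lead :: "'n::linorder mpoly \<Rightarrow> 'n \<Rightarrow>\<^sub>0 nat" where
  "lead p = Max (keys p)"

lemma lead_in_keys: "p \<noteq> 0 \<Longrightarrow> lead p \<in> keys p"
  by (simp add: lead_def)

lemma le_lead: "\<alpha> \<in> keys p \<Longrightarrow> \<alpha> \<le> lead p"
  by (simp add: lead_def)

text \<open>The quotient of the coefficients cancels the leading term of \<open>f\<close>, and
  shifting by a multi-index preserves the order, so no larger term arises.\<close>

lemma lead_reduce:
  fixes f g :: "'n::linorder mpoly"
  assumes "f \<noteq> 0" "g \<noteq> 0" "index_dvd (lead g) (lead f)"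
  defines "h \<equiv> f - single (lead f - lead g) (lookup f (lead f) / lookup g (lead g)) * g"
  shows "h = 0 \<or> lead h < lead f"
proof (cases "h = 0")
  case False
  define \<beta> where "\<beta> = lead f - lead g"
  define c where "c = lookup f (lead f) / lookup g (lead g)"
  have h: "h = f - single \<beta> c * g" by (simp add: h_def \<beta>_def c_def)
  have \<beta>: "\<beta> + lead g = lead f"
    using assms(3) by (simp add: \<beta>_def index_dvd_diff_add)
  have "lookup (single \<beta> c * g) (lead f) = lookup f (lead f)"
    using lookup_single_mult[of \<beta> c g "lead g"] lead_in_keys[OF \<open>g \<noteq> 0\<close>]
    by (simp add: \<beta> c_def in_keys_iff)
  then have "lookup h (lead f) = 0" by (simp add: h lookup_minus)
  then have ne: "lead h \<noteq> lead f"
    using lead_in_keys[OF False] by (auto simp: in_keys_iff)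
  have "\<gamma> \<le> lead f" if \<gamma>: "\<gamma> \<in> keys (single \<beta> c * g)" for \<gamma>
  proof -
    obtain \<delta> where "\<delta> \<in> keys g" "\<gamma> = \<beta> + \<delta>"
      using \<gamma> keys_mult[of "single \<beta> c" g] by (auto split: if_splits)
    then show ?thesis using le_lead[of \<delta> g] \<beta> by (metis add_left_mono)
  qed
  moreover have "keys h \<subseteq> keys f \<union> keys (single \<beta> c * g)"
    by (auto simp: h in_keys_iff lookup_minus)
  ultimately have "lead h \<le> lead f"
    using lead_in_keys[OF False] le_lead[of _ f] by blast
  with ne show ?thesis by (simp add: less_le)
qed simp

text \<open>
  The pairs \<open>(f, n)\<close> with \<open>f\<close> of order at least \<open>n\<close> are the homogeneous elements of the extended
  Rees algebra \<open>\<complex>[X\<^sub>1, \<dots>, X\<^sub>N, s]\<close>, where \<open>x\<^sub>i = X\<^sub>i s\<close>. The monomial \<open>x\<^sup>\<alpha>\<close> in degree \<open>n\<close> is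
  \<open>X\<^sup>\<alpha> s\<^bsup>|\<alpha>| - n\<^esup>\<close>, which accounts for the second divisibility condition below.
\<close>

lemma lead_bound:
  fixes J :: "'n::{finite,linorder} mpoly set"
  shows "\<exists>c. \<forall>n f. f \<in> J \<inter> order_ge n \<and> f \<noteq> 0 \<longrightarrow>
    (\<exists>m\<le>c. \<exists>g\<in>J \<inter> order_ge m. g \<noteq> 0 \<and> index_dvd (lead g) (lead f) \<and>
      index_degree (lead g) + n \<le> index_degree (lead f) + m)"
proof (rule ccontr)
  define P where "P n f m g \<longleftrightarrow> g \<in> J \<inter> order_ge m \<and> g \<noteq> 0 \<and> index_dvd (lead g) (lead f) \<and>
      index_degree (lead g) + n \<le> index_degree (lead f) + m" for n m and f g :: "'n mpoly"
  assume "\<not> ?thesis"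
  moreover have "(\<exists>g\<in>J \<inter> order_ge m. g \<noteq> 0 \<and> index_dvd (lead g) (lead f) \<and>
      index_degree (lead g) + n \<le> index_degree (lead f) + m) \<longleftrightarrow> (\<exists>g. P n f m g)" for n m f
    by (simp add: P_def Bex_def)
  ultimately have "\<forall>c. \<exists>n f. f \<in> J \<inter> order_ge n \<and> f \<noteq> 0 \<and> (\<forall>m\<le>c. \<forall>g. \<not> P n f m g)"
    by simp
  then obtain n f where nf: "\<And>c. f c \<in> J \<inter> order_ge (n c)" "\<And>c. f c \<noteq> 0"
    and bad: "\<And>c m g. m \<le> c \<Longrightarrow> \<not> P (n c) (f c) m g" by metis
  \<comment> \<open>\<open>Some i\<close> is the exponent of \<open>X_i\<close> and
    \<open>None\<close> that of \<open>s\<close> in the leading monomial.\<close>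
  define v where "v i c = (case i of None \<Rightarrow> index_degree (lead (f c)) - n c
      | Some i \<Rightarrow> lookup (lead (f c)) i)" for i :: "'n option" and c
  obtain s :: "nat \<Rightarrow> nat" where s: "strict_mono s" "\<And>i. mono (v i \<circ> s)"
    using dickson_subseq[of "UNIV :: 'n option set" v] by auto
  define a where "a = s 0"
  \<comment> \<open>Chosen so that \<open>n a \<le> b\<close>: the pair of \<open>f a\<close> and
    \<open>n a\<close> is then among those ruled out for \<open>f b\<close>.\<close>
  define b where "b = s (n a)"
  have v: "v i a \<le> v i b" for i
    using s(2)[of i] by (simp add: a_def b_def mono_def)
  \<comment> \<open>Makes the truncated subtraction in \<open>v None\<close> exact.\<close>
  have deg: "n c \<le> index_degree (lead (f c))" for c
    using nf(1)[of c] lead_in_keys[OF nf(2)[of c]] by (auto simp: order_ge_def)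
  have "index_dvd (lead (f a)) (lead (f b))"
    using v[of "Some _"] by (auto simp: index_dvd_def v_def)
  moreover have "index_degree (lead (f a)) + n b \<le> index_degree (lead (f b)) + n a"
    using v[of None] deg[of a] deg[of b] by (simp add: v_def)
  ultimately have "P (n b) (f b) (n a) (f a)"
    using nf[of a] by (simp add: P_def)
  moreover have "n a \<le> b"
    using strict_mono_imp_increasing[OF s(1)] by (simp add: b_def)
  ultimately show False using bad by blast
qed

text \<open>Division as for Groebner bases, by induction on \<open>lead f\<close>: subtract a
  monomial multiple of the \<open>g\<close> from \<open>lead_bound\<close>. The constant is the
  bound on \<open>m\<close> there.\<close>

theorem artin_rees:
  fixes J :: "'n::{finite,linorder} mpoly set"
  assumes J: "is_ideal J"
  shows "\<exists>c. \<forall>n. J \<inter> order_ge n \<subseteq> generated_ideal {a * b |a b. a \<in> order_ge (n - c) \<and> b \<in> J}"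
proof -
  obtain c where c: "\<And>n f. f \<in> J \<inter> order_ge n \<Longrightarrow> f \<noteq> 0 \<Longrightarrow>
    \<exists>m\<le>c. \<exists>g\<in>J \<inter> order_ge m. g \<noteq> 0 \<and> index_dvd (lead g) (lead f) \<and>
      index_degree (lead g) + n \<le> index_degree (lead f) + m"
    using lead_bound[of J] by blast
  have J_diff: "f - a * g \<in> J" if "f \<in> J" "g \<in> J" for f a g
    using that J module.subspace_diff[OF module_mult] module.subspace_scale[OF module_mult] by metis
  have "f \<in> generated_ideal {a * b |a b. a \<in> order_ge (n - c) \<and> b \<in> J}" (is "_ \<in> ?S")
    if "f \<in> J \<inter> order_ge n" for n f
    using that
  proof (induction "lead f" arbitrary: f rule: wf_induct_rule[OF wf_index])
    case 1
    show ?case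
    proof (cases "f = 0")
      case True
      then show ?thesis by (simp add: module.span_zero[OF module_mult])
    next
      case False
      obtain m g where g: "m \<le> c" "g \<in> J" "g \<in> order_ge m" "g \<noteq> 0" "index_dvd (lead g) (lead f)"
        "index_degree (lead g) + n \<le> index_degree (lead f) + m"
        using c[OF 1(2) False] by blast
      define t where "t = single (lead f - lead g) (lookup f (lead f) / lookup g (lead g))"
      have "index_degree (lead f - lead g) + index_degree (lead g) = index_degree (lead f)"
        using index_dvd_diff_add[OF g(5)] by (metis index_degree_add)
      \<comment> \<open>This inequality serves twice: \<open>t\<close> has order at least
        \<open>n - m\<close>, hence \<open>n - c\<close>, and \<open>t * g\<close> has order at
        least \<open>n\<close>.\<close>
      with g(6) have n: "n \<le> index_degree (lead f - lead g) + m" by simp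
      have "t \<in> order_ge (n - c)"
        unfolding t_def using n g(1) by (intro single_in_order_ge) simp
      with g(2) have tg: "t * g \<in> ?S"
        by (auto intro!: module.span_base[OF module_mult])
      have "t * g \<in> order_ge (index_degree (lead f - lead g) + m)"
        unfolding t_def using g(3) by (intro order_ge_mult single_in_order_ge) auto
      with n have tgn: "t * g \<in> order_ge n" using order_ge_antimono by blast
      have "f - t * g \<in> J \<inter> order_ge n"
        using 1(2) tgn J_diff[OF _ g(2)] order_ge_diff by blast
      moreover have "f - t * g = 0 \<or> lead (f - t * g) < lead f"
        unfolding t_def by (rule lead_reduce) (use g False in auto)
      ultimately have "f - t * g \<in> ?S"
        using 1(1)[of "f - t * g"] by (auto simp: module.span_zero[OF module_mult])
      from module.span_add[OF module_mult this tg] show ?thesis by simp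
    qed
  qed
  then show ?thesis by blast
qed

text \<open>Artin--Rees for the ideal \<open>I + \<langle>h\<rangle>\<close>.\<close>

lemma colon_approximation:
  fixes I :: "'n::{finite,linorder} mpoly set"
  assumes I: "is_ideal I"
  shows "\<exists>n. \<forall>a\<in>I. \<forall>f. h * f - a \<in> order_ge n \<longrightarrow> (\<exists>g\<in>order_ge k. h * (f - g) \<in> I)"
proof -
  note ideal = module.subspace_add[OF module_mult] module.subspace_scale[OF module_mult]
    module.subspace_diff[OF module_mult] module.subspace_0[OF module_mult]
  define J where "J = {a + h * f |a f. a \<in> I}"
  \<comment> \<open>Used for two values of \<open>m\<close>: zero yields \<open>J\<close>, and
    \<open>k\<close> yields the ideal absorbing the Artin--Rees generators.\<close>
  have ideal_J: "is_ideal {a + h * f |a f. a \<in> I \<and> f \<in> order_ge m}" for m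
    unfolding module.subspace_def[OF module_mult]
  proof (safe, goal_cases)
    case 1
    show ?case using ideal(4)[OF I] order_ge_zero[of m]
      by (intro exI[of _ 0]) simp
  next
    case (2 x y a b f g)
    then show ?case
      using ideal(1)[OF I] order_ge_add
      by (intro exI[of _ "a + b"] exI[of _ "f + g"]) (simp add: algebra_simps)
  next
    case (3 c x a f)
    then show ?case
      using ideal(2)[OF I, of a c] order_ge_mult_left[of f m c]
      by (intro exI[of _ "c * a"] exI[of _ "c * f"]) (simp add: distrib_left mult.left_commute)
  qed
  have J: "is_ideal J"
    using ideal_J[of 0] by (simp add: J_def order_ge_def)
  obtain c where c: "\<And>n. J \<inter> order_ge n \<subseteq> generated_ideal {a * b |a b. a \<in> order_ge (n - c) \<and> b \<in> J}"
    using artin_rees[OF J] by blast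
  have "{a * b |a b. a \<in> order_ge k \<and> b \<in> J} \<subseteq> {a + h * f |a f. a \<in> I \<and> f \<in> order_ge k}"
  proof safe
    fix a b :: "'n mpoly"
    assume a: "a \<in> order_ge k" and "b \<in> J"
    then obtain b' f where "b = b' + h * f" "b' \<in> I" by (auto simp: J_def)
    then show "\<exists>a' f'. a * b = a' + h * f' \<and> a' \<in> I \<and> f' \<in> order_ge k"
      using a ideal(2)[OF I, of b' a] order_ge_mult_left[of a k f]
      by (intro exI[of _ "a * b'"] exI[of _ "f * a"]) (simp add: distrib_left ac_simps)
  qed
  \<comment> \<open>At order \<open>k + c\<close>, the bound \<open>n - c\<close> of
    \<open>artin_rees\<close> becomes \<open>k\<close>.\<close>
  from module.span_minimal[OF module_mult this ideal_J]
  have sub: "J \<inter> order_ge (k + c) \<subseteq> {a + h * f |a f. a \<in> I \<and> f \<in> order_ge k}"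
    using c[of "k + c"] by simp
  have "\<exists>g\<in>order_ge k. h * (f - g) \<in> I" if a: "a \<in> I" and "h * f - a \<in> order_ge (k + c)" for a f
  proof -
    have "h * f - a \<in> J"
      unfolding J_def using module.subspace_neg[OF module_mult I a]
      by (intro CollectI exI[of _ "-a"] exI[of _ f]) simp
    with that sub obtain b g where b: "h * f - a = b + h * g" "b \<in> I" "g \<in> order_ge k" by blast
    then have "h * (f - g) = b + a" by (simp add: algebra_simps)
    with a b ideal(1)[OF I] show ?thesis by metis
  qed
  then show ?thesis by blast
qed

section \<open>Extension of functionals\<close>

text \<open>The values prescribed on \<open>W\<close> and on the range of \<open>T\<close> are
  compatible by \<open>ker\<close>. They are imposed on a basis \<open>C\<close> of the span of both
  sets, which extends a basis \<open>B\<close> of \<open>W\<close>.\<close>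

lemma (in vector_space_pair) linear_extend_along:
  assumes T: "Vector_Spaces.linear s1 s1 T" and q: "Vector_Spaces.linear s1 s2 q" and W: "vs1.subspace W"
    and ker: "\<And>p. T p \<in> W \<Longrightarrow> q p = 0"
  shows "\<exists>\<phi>. Vector_Spaces.linear s1 s2 \<phi> \<and> (\<forall>w\<in>W. \<phi> w = 0) \<and> (\<forall>p. \<phi> (T p) = q p)"
proof -
  interpret T: Vector_Spaces.linear s1 s1 T by (rule T)
  interpret q: Vector_Spaces.linear s1 s2 q by (rule q)
  obtain B where B: "B \<subseteq> W" "vs1.independent B" "W \<subseteq> vs1.span B"
    using vs1.maximal_independent_subset[of W] by metis
  obtain C where C: "B \<subseteq> C" "C \<subseteq> W \<union> range T" "vs1.independent C" "W \<union> range T \<subseteq> vs1.span C"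
    using vs1.maximal_independent_subset_extend[of B "W \<union> range T"] B by (metis le_supI1)
  \<comment> \<open>A basis element outside \<open>W\<close> lies in the range of \<open>T\<close>;
    an arbitrary preimage fixes its value.\<close>
  have C_ex: "\<exists>\<psi>. Vector_Spaces.linear s1 s2 \<psi> \<and> (\<forall>b\<in>C. \<psi> b = (if b \<in> W then 0 else q (SOME p. b = T p)))"
    by (rule linear_independent_extend) (rule C)
  then obtain \<phi> where \<phi>: "Vector_Spaces.linear s1 s2 \<phi>"
    and \<phi>_C: "\<And>b. b \<in> C \<Longrightarrow> \<phi> b = (if b \<in> W then 0 else q (SOME p. b = T p))" by blast
  interpret \<phi>: Vector_Spaces.linear s1 s2 \<phi> by (rule \<phi>)
  have zero: "\<phi> w = 0" if "w \<in> W" for w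
  proof -
    have "w \<in> vs1.span B" using that B(3) by blast
    then show ?thesis
    proof (induction rule: vs1.span_induct_alt)
      case base
      show ?case by (rule \<phi>.zero)
    next
      case (step c x y)
      have "x \<in> C" "x \<in> W" using step(1) B(1) C(1) by auto
      then have "\<phi> x = 0" using \<phi>_C[of x] by simp
      with step show ?case by (simp add: \<phi>.add \<phi>.scale)
    qed
  qed
  have decomp: "\<exists>w\<in>W. \<exists>p. x = w + T p \<and> \<phi> x = q p" if "x \<in> vs1.span C" for x
    using that
  proof (induction rule: vs1.span_induct_alt)
    case base
    show ?case
      using vs1.subspace_0[OF W] by (intro bexI[of _ 0] exI[of _ 0]) (simp_all add: \<phi>.zero T.zero q.zero)
  next
    case (step c b x)
    then obtain w p where p: "w \<in> W" "x = w + T p" "\<phi> x = q p" by blast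
    show ?case
    proof (cases "b \<in> W")
      case True
      then have "s1 c b + w \<in> W"
        using p(1) W by (intro vs1.subspace_add vs1.subspace_scale)
      then show ?thesis
        using p zero[OF True]
        by (intro bexI[of _ "s1 c b + w"] exI[of _ p]) (simp_all add: \<phi>.add \<phi>.scale add.assoc)
    next
      case False
      define r where "r = (SOME r. b = T r)"
      have "\<exists>r. b = T r" using False step(1) C(2) by blast
      then have r: "b = T r" unfolding r_def by (rule someI_ex)
      have "\<phi> b = q r" using \<phi>_C[OF step(1)] False by (simp add: r_def)
      then show ?thesis
        using p r
        by (intro bexI[of _ w] exI[of _ "s1 c r + p"])
          (simp_all add: \<phi>.add \<phi>.scale q.add q.scale T.add T.scale add_ac)
    qed
  qed
  have "\<phi> (T p) = q p" for p
  proof -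
    have "T p \<in> vs1.span C" using C(4) by blast
    then obtain w r where r: "w \<in> W" "T p = w + T r" "\<phi> (T p) = q r" using decomp by blast
    \<comment> \<open>Independence of the chosen preimages: \<open>p\<close> and \<open>r\<close>
      differ by an element that \<open>T\<close> sends into \<open>W\<close>.\<close>
    then have "T (p - r) = w" by (simp add: T.diff)
    with r(1) ker[of "p - r"] have "q p = q r" by (simp add: q.diff)
    with r(3) show ?thesis by simp
  qed
  with \<phi> zero show ?thesis by blast
qed

section \<open>The action of a coordinate on the dual space\<close>

lemma frac_mult:
  "q \<notin> origin_ideal \<Longrightarrow> s \<notin> origin_ideal \<Longrightarrow> frac p q * frac r s = frac (p * r) (q * s)"
  by transfer (simp add: local_rel_def origin_ideal_iff)

lemma frac_add:
  "q \<notin> origin_ideal \<Longrightarrow> s \<notin> origin_ideal \<Longrightarrow> frac p q + frac r s = frac (p * s + r * q) (q * s)"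
  by transfer (simp add: local_rel_def origin_ideal_iff)

lemma pderiv_add: "pderiv i (f + g) = pderiv i f + pderiv i g"
  by transfer
    (auto simp: local_rel_def origin_ideal_iff mpoly_pderiv_add mpoly_pderiv_mult algebra_simps)

lemma pderiv_mult: "pderiv i (f * g) = pderiv i f * g + f * pderiv i g"
  by transfer
    (auto simp: local_rel_def origin_ideal_iff mpoly_pderiv_mult algebra_simps)

lemma at0_add: "at0 (f + g) = at0 f + at0 g"
  by transfer (auto simp: local_rel_def origin_ideal_iff field_simps)

lemma at0_mult: "at0 (f * g) = at0 f * at0 g"
  by transfer (auto simp: local_rel_def)

lemma one_notin_origin_ideal: "1 \<notin> origin_ideal"
  by (simp add: origin_ideal_iff)

lemma frac_zero_one: "frac 0 1 = 0"
  by transfer (simp add: local_rel_def origin_ideal_iff)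

lemma frac_one_one: "frac 1 1 = 1"
  by transfer (simp add: local_rel_def origin_ideal_iff)

lemma at0_coord: "at0 (coord i) = 0"
  by (simp add: coord_def at0_frac_one)

lemma pderiv_coord: "pderiv j (coord i) = (if i = j then 1 else 0)"
proof -
  have "mpoly_pderiv j (Var i) = (if i = j then 1 else 0)"
    by (auto simp: Var_def mpoly_pderiv_single lookup_single)
  then show ?thesis
    by (simp add: coord_def frac_one_pderiv frac_zero_one frac_one_one)
qed

lemma pderiv_zero: "pderiv i 0 = 0"
  using pderiv_add[of i 0 0] by simp

lemma pderiv_of_nat: "pderiv i (of_nat n) = 0"
proof (induction n)
  case (Suc n)
  have "pderiv i 1 = 0" using pderiv_mult[of i 1 1] by simp
  with Suc show ?case by (simp add: pderiv_add)
qed (simp add: pderiv_zero)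

lemma pderiv_pow_add: "(pderiv i ^^ k) (f + g) = (pderiv i ^^ k) f + (pderiv i ^^ k) g"
  by (induction k) (simp_all add: pderiv_add)

lemma pderiv_pow_of_nat_mult: "(pderiv i ^^ k) (of_nat n * f) = of_nat n * (pderiv i ^^ k) f"
  by (induction k) (simp_all add: pderiv_mult pderiv_of_nat)

lemma pderiv_pow_zero: "(pderiv i ^^ k) 0 = 0"
  using pderiv_pow_of_nat_mult[of k i 0 0] by simp

text \<open>Leibniz rule for a factor with vanishing second derivatives. At \<open>k = 0\<close> the
  truncated \<open>k - 1\<close> is masked by the factor \<open>of_nat k\<close>.\<close>

lemma pderiv_pow_coord_mult:
  "(pderiv j ^^ k) (coord i * f) =
    coord i * (pderiv j ^^ k) f + (if i = j then of_nat k * (pderiv j ^^ (k - 1)) f else 0)"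
proof (induction k)
  case (Suc k)
  show ?case
  proof (cases k)
    case 0
    then show ?thesis by (simp add: pderiv_mult pderiv_coord)
  next
    case (Suc k')
    with Suc.IH show ?thesis
      by (auto simp: pderiv_add pderiv_mult pderiv_coord pderiv_of_nat pderiv_zero algebra_simps)
  qed
qed simp

text \<open>By distinctness the derivatives in direction \<open>j\<close> are applied at most once;
  those in other directions pass through \<open>coord j\<close>.\<close>

lemma foldr_pderiv_coord_mult:
  assumes "distinct xs"
  shows "foldr (\<lambda>i. pderiv i ^^ lookup \<alpha> i) xs (coord j * f) =
    coord j * foldr (\<lambda>i. pderiv i ^^ lookup \<alpha> i) xs f +
    (if j \<in> set xs then of_nat (lookup \<alpha> j) *
      foldr (\<lambda>i. pderiv i ^^ lookup (\<alpha> - single j 1) i) xs f else 0)"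
  using assms
proof (induction xs)
  case (Cons i xs)
  have cong: "foldr (\<lambda>i. pderiv i ^^ lookup (\<alpha> - single j 1) i) xs f =
      foldr (\<lambda>i. pderiv i ^^ lookup \<alpha> i) xs f" if "j \<notin> set xs"
    using that by (intro foldr_cong) (auto simp: lookup_minus lookup_single when_def)
  show ?case
    using Cons cong
    by (auto simp: pderiv_pow_add pderiv_pow_of_nat_mult pderiv_pow_coord_mult pderiv_pow_zero lookup_minus lookup_single)
qed simp

lemma at0_of_nat: "at0 (of_nat n) = of_nat n"
proof (induction n)
  case 0
  show ?case using at0_frac_one[of 0] by (simp add: frac_zero_one)
next
  case (Suc n)
  have "at0 1 = 1" using at0_frac_one[of 1] by (simp add: frac_one_one)
  with Suc show ?case by (simp add: at0_add)
qed

section \<open>The functionals at the origin under multiplication\<close>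

text \<open>The Leibniz summand retaining \<open>coord j\<close> vanishes at the origin; the factor
  \<open>lookup \<alpha> j\<close> of the other one cancels against the factorials.\<close>

lemma dpoint_coord_mult:
  "dpoint \<alpha> (coord j * f) = (if lookup \<alpha> j = 0 then 0 else dpoint (\<alpha> - single j 1) f)"
proof -
  let ?\<beta> = "\<alpha> - single j (1::nat)"
  have "at0 (mixed_pderiv \<alpha> (coord j * f)) = of_nat (lookup \<alpha> j) * at0 (mixed_pderiv ?\<beta> f)"
    by (simp add: mixed_pderiv_def foldr_pderiv_coord_mult at0_add at0_mult at0_coord at0_of_nat)
  moreover have "(\<Prod>i\<in>UNIV. fact (lookup \<alpha> i)) =
      of_nat (lookup \<alpha> j) * (\<Prod>i\<in>UNIV. fact (lookup ?\<beta> i) :: complex)"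
    if "lookup \<alpha> j \<noteq> 0"
  proof -
    have "(\<Prod>i\<in>UNIV - {j}. fact (lookup \<alpha> i)) = (\<Prod>i\<in>UNIV - {j}. fact (lookup ?\<beta> i) :: complex)"
      by (intro prod.cong) (auto simp: lookup_minus lookup_single)
    with that show ?thesis
      by (simp add: prod.remove[of UNIV j] lookup_minus fact_reduce)
  qed
  ultimately show ?thesis
    by (simp add: dpoint_def)
qed

lemma dpoint_add: "dpoint \<alpha> (f + g) = dpoint \<alpha> f + dpoint \<alpha> g"
proof -
  have "foldr (\<lambda>i. pderiv i ^^ lookup \<alpha> i) xs (f + g) =
      foldr (\<lambda>i. pderiv i ^^ lookup \<alpha> i) xs f + foldr (\<lambda>i. pderiv i ^^ lookup \<alpha> i) xs g" for xs
    by (induction xs) (simp_all add: pderiv_pow_add)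
  then show ?thesis by (simp add: dpoint_def mixed_pderiv_def at0_add add_divide_distrib)
qed

lemma dpoint_const_mult:
  fixes f :: "'n::{finite,linorder} local_ring"
  shows "dpoint \<alpha> (frac (single 0 k) 1 * f) = k * dpoint \<alpha> f"
proof -
  let ?k = "frac (single 0 k) 1 :: 'n local_ring"
  have "pderiv i ?k = 0" for i
    by (simp add: frac_one_pderiv mpoly_pderiv_single frac_zero_one)
  then have "pderiv i (?k * g) = ?k * pderiv i g" for i g
    by (simp add: pderiv_mult)
  then have "(pderiv i ^^ n) (?k * g) = ?k * (pderiv i ^^ n) g" for i n g
    by (induction n) simp_all
  then have "foldr (\<lambda>i. pderiv i ^^ lookup \<alpha> i) xs (?k * f) =
      ?k * foldr (\<lambda>i. pderiv i ^^ lookup \<alpha> i) xs f" for xs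
    by (induction xs) simp_all
  moreover have "at0 ?k = k"
    by (simp add: at0_frac_one mpoly_at0_def)
  ultimately show ?thesis
    by (simp add: dpoint_def mixed_pderiv_def at0_mult)
qed

lemma frac_one_mult: "frac p 1 * frac q 1 = frac (p * q) 1"
  by (simp add: frac_mult one_notin_origin_ideal)

lemma frac_one_add: "frac p 1 + frac q 1 = frac (p + q) 1"
  by (simp add: frac_add one_notin_origin_ideal)

lemma frac_one_mult_frac: "s \<notin> origin_ideal \<Longrightarrow> frac p 1 * frac r s = frac (p * r) s"
  by (simp add: frac_mult one_notin_origin_ideal)

text \<open>Congruence modulo the \<open>n\<close>-th power of the maximal ideal survives
  multiplication by a polynomial. This later permits replacing an inverse by its Taylor
  polynomial.\<close>

lemma dpoint_cong_mult:
  assumes "\<And>\<alpha>. index_degree \<alpha> < n \<Longrightarrow> dpoint \<alpha> f = dpoint \<alpha> g"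
  shows "index_degree \<alpha> < n \<Longrightarrow> dpoint \<alpha> (frac p 1 * f) = dpoint \<alpha> (frac p 1 * g)"
proof (induction p arbitrary: \<alpha> rule: mpoly_induct)
  case (monom \<beta> k)
  then show ?case
  proof (induction "index_degree \<beta>" arbitrary: \<alpha> \<beta> rule: less_induct)
    case less
    show ?case
    proof (cases "\<beta> = 0")
      case True
      with assms less.prems show ?thesis by (simp add: dpoint_const_mult)
    next
      case False
      then obtain j where "0 < lookup \<beta> j"
        by (auto simp: poly_mapping_eq_iff fun_eq_iff)
      then have \<beta>: "\<beta> = \<beta> - single j 1 + single j 1"
        by (rule multi_index_pos_decomp)
      let ?\<beta> = "\<beta> - single j (1::nat)"
      have deg_single: "index_degree (single j (1::nat)) = 1"
        by (simp add: index_degree_def lookup_single when_def)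
      have "index_degree \<beta> = index_degree ?\<beta> + 1"
        by (subst \<beta>) (simp only: index_degree_add deg_single)
      then have IH: "dpoint \<gamma> (frac (single ?\<beta> k) 1 * f) = dpoint \<gamma> (frac (single ?\<beta> k) 1 * g)"
        if "index_degree \<gamma> < n" for \<gamma>
        using less.hyps that by simp
      have "frac (single \<beta> k) 1 = coord j * frac (single ?\<beta> k) 1"
        by (subst \<beta>) (simp add: coord_def Var_def frac_one_mult mult_single add.commute)
      moreover have "index_degree (\<alpha> - single j 1) \<le> index_degree \<alpha>"
        by (auto simp: index_degree_def lookup_minus intro: sum_mono)
      ultimately show ?thesis
        using less.prems IH[of "\<alpha> - single j 1"] by (simp add: mult.assoc dpoint_coord_mult)
    qed
  qed
next
  case (add p q)
  then show ?case by (simp add: distrib_right dpoint_add flip: frac_one_add)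
qed

lemma finite_index_degree_less: "finite {\<alpha> :: 'n::finite \<Rightarrow>\<^sub>0 nat. index_degree \<alpha> < n}"
proof -
  have "lookup \<alpha> i \<le> index_degree \<alpha>" for i and \<alpha> :: "'n \<Rightarrow>\<^sub>0 nat"
    unfolding index_degree_def by (rule member_le_sum) auto
  then have "lookup \<alpha> i < n" if "index_degree \<alpha> < n" for i and \<alpha> :: "'n \<Rightarrow>\<^sub>0 nat"
    using that by (rule le_less_trans)
  then have "lookup ` {\<alpha> :: 'n \<Rightarrow>\<^sub>0 nat. index_degree \<alpha> < n} \<subseteq>
      {f. \<forall>i. (i \<in> UNIV \<longrightarrow> f i \<in> {..<n}) \<and> (i \<notin> UNIV \<longrightarrow> f i = 0)}"
    by auto
  moreover have "finite {f :: 'n \<Rightarrow> nat. \<forall>i. (i \<in> UNIV \<longrightarrow> f i \<in> {..<n}) \<and> (i \<notin> UNIV \<longrightarrow> f i = 0)}"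
    by (rule finite_set_of_finite_funs) auto
  ultimately have "finite (lookup ` {\<alpha> :: 'n \<Rightarrow>\<^sub>0 nat. index_degree \<alpha> < n})"
    by (rule finite_subset)
  then show ?thesis
    by (rule finite_imageD) (intro inj_onI poly_mapping_eqI, simp)
qed

lemma poly_mapping_exists:
  fixes \<phi> :: "'a \<Rightarrow> 'b::comm_monoid_add"
  assumes "finite S"
  shows "\<exists>c. \<forall>\<alpha>. lookup c \<alpha> = (if \<alpha> \<in> S then \<phi> \<alpha> else 0)"
  using assms
  by (intro exI[of _ "\<Sum>\<alpha>\<in>S. single \<alpha> (\<phi> \<alpha>)"]) (simp add: lookup_sum lookup_single when_def)

section \<open>Finite combinations and the shift of their coefficients\<close>

lemma dcomb_add: "dcomb c (f + g) = dcomb c f + dcomb c g"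
  by (simp add: dcomb_def dpoint_add distrib_left sum.distrib)

lemma dcomb_const_mult: "dcomb c (frac (single 0 k) 1 * f) = k * dcomb c f"
  by (simp add: dcomb_def dpoint_const_mult sum_distrib_left mult.left_commute)

lemma dcomb_frac_one_single: "dcomb c (frac (single \<beta> k) 1) = lookup c \<beta> * k"
  by (auto simp: dcomb_def dpoint_frac_one lookup_single when_def if_distrib in_keys_iff cong: if_cong)

text \<open>Terms with \<open>lookup \<alpha> j = 0\<close> are killed; on the others, lowering the
  exponent is a bijection onto the terms of \<open>b\<close>.\<close>

lemma act_coord_dcomb:
  assumes "\<And>\<beta>. lookup b \<beta> = lookup c (\<beta> + single j 1)"
  shows "act (coord j) (dcomb c) = dcomb b"
proof
  fix f
  have "dcomb c (coord j * f) =
      (\<Sum>\<alpha>\<in>{\<alpha> \<in> keys c. lookup \<alpha> j \<noteq> 0}. lookup c \<alpha> * dpoint (\<alpha> - single j 1) f)"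
    unfolding dcomb_def by (rule sum.mono_neutral_cong_right) (auto simp: dpoint_coord_mult)
  also have "\<dots> = (\<Sum>\<beta>\<in>keys b. lookup b \<beta> * dpoint \<beta> f)"
  proof (rule sum.reindex_bij_witness[of _ "\<lambda>\<beta>. \<beta> + single j 1" "\<lambda>\<alpha>. \<alpha> - single j 1"])
    fix \<alpha> assume "\<alpha> \<in> {\<alpha> \<in> keys c. lookup \<alpha> j \<noteq> 0}"
    then have \<alpha>: "\<alpha> \<in> keys c" "\<alpha> - single j 1 + single j 1 = \<alpha>"
      using multi_index_pos_decomp[of \<alpha> j] by auto
    then show "\<alpha> - single j 1 + single j 1 = \<alpha>" by simp
    have b: "lookup b (\<alpha> - single j 1) = lookup c \<alpha>"
      using assms[of "\<alpha> - single j 1"] \<alpha>(2) by simp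
    then show "\<alpha> - single j 1 \<in> keys b" using \<alpha>(1) by (simp add: in_keys_iff)
    show "lookup b (\<alpha> - single j 1) * dpoint (\<alpha> - single j 1) f =
        lookup c \<alpha> * dpoint (\<alpha> - single j 1) f" by (simp only: b)
  next
    fix \<beta> assume "\<beta> \<in> keys b"
    then show "\<beta> + single j 1 \<in> {\<alpha> \<in> keys c. lookup \<alpha> j \<noteq> 0}"
      using assms[of \<beta>] by (simp add: in_keys_iff lookup_add)
  qed simp
  finally show "act (coord j) (dcomb c) f = dcomb b f"
    by (simp add: act_def dcomb_def)
qed

lemma act_coord_dcomb_exists:
  "\<exists>b. act (coord j) (dcomb c) = dcomb b \<and> (\<forall>\<beta>. lookup b \<beta> = lookup c (\<beta> + single j 1))"
proof -
  let ?S = "(\<lambda>\<beta>. \<beta> + single j 1) -` keys c"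
  have "finite ?S" by (rule finite_vimageI) (auto simp: inj_on_def)
  from poly_mapping_exists[OF this, of "\<lambda>\<beta>. lookup c (\<beta> + single j 1)"]
  obtain b where "\<And>\<beta>. lookup b \<beta> = (if \<beta> \<in> ?S then lookup c (\<beta> + single j 1) else 0)" by blast
  then have "lookup b \<beta> = lookup c (\<beta> + single j 1)" for \<beta>
    by (auto simp: in_keys_iff)
  with act_coord_dcomb show ?thesis by blast
qed

section \<open>Lifting a functional along a coordinate\<close>

lemma vector_space_mpoly: "vector_space (\<lambda>k (p :: 'n mpoly). single 0 k * p)"
  by standard (simp_all add: algebra_simps single_add mult_single flip: mult.assoc)

text \<open>The lift \<open>\<phi>\<close> is built on polynomials, where
  \<open>colon_approximation\<close> applies, and then transferred to fractions.\<close>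

lemma dual_coord_lift:
  fixes I :: "'n::{finite,linorder} local_ring set"
  assumes I: "is_ideal I" and b: "\<And>f. f \<in> colon I (coord j) \<Longrightarrow> dcomb b f = 0"
  shows "\<exists>c. (\<forall>f\<in>I. dcomb c f = 0) \<and> act (coord j) (dcomb c) = dcomb b"
proof -
  let ?s = "\<lambda>k (p :: 'n mpoly). single 0 k * p"
  interpret P: vector_space ?s by (rule vector_space_mpoly)
  interpret vector_space_pair ?s "(*) :: complex \<Rightarrow> complex \<Rightarrow> complex"
    by standard (simp_all add: algebra_simps)
  note I_add = module.subspace_add[OF module_mult] and I_scale = module.subspace_scale[OF module_mult]
  define Ic where "Ic = {p. frac p 1 \<in> I}"
  have Ic: "is_ideal Ic"
    unfolding module.subspace_def[OF module_mult] Ic_def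
    using module.subspace_0[OF module_mult I] I_add[OF I] I_scale[OF I]
    by (simp add: frac_zero_one flip: frac_one_add frac_one_mult)
  define q where "q p = dcomb b (frac p 1)" for p
  \<comment> \<open>Exceeds the degree of every term of \<open>b\<close>, so that \<open>q\<close>
    vanishes on \<open>order_ge k\<close>; inserting \<open>0\<close> covers
    \<open>b = 0\<close>.\<close>
  define k where "k = Suc (Max (insert 0 (index_degree ` keys b)))"
  have q_order: "q p = 0" if "p \<in> order_ge k" for p
  proof -
    have "index_degree \<alpha> < k" if "\<alpha> \<in> keys b" for \<alpha>
      using that by (simp add: k_def less_Suc_eq_le)
    then have "lookup p \<alpha> = 0" if "\<alpha> \<in> keys b" for \<alpha>
      using that \<open>p \<in> order_ge k\<close> by (force simp: order_ge_def in_keys_iff)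
    then show ?thesis by (simp add: q_def dcomb_def dpoint_frac_one)
  qed
  have q_add: "q (p + r) = q p + q r" for p r
    by (simp add: q_def dcomb_add flip: frac_one_add)
  have q: "Vector_Spaces.linear ?s (*) q"
    by unfold_locales (rule q_add, simp add: q_def dcomb_const_mult flip: frac_one_mult)
  have T: "Vector_Spaces.linear ?s ?s ((*) (Var j))"
    by unfold_locales (simp_all add: algebra_simps)
  obtain n where n: "\<And>a f. a \<in> Ic \<Longrightarrow> Var j * f - a \<in> order_ge n \<Longrightarrow>
      \<exists>g\<in>order_ge k. Var j * (f - g) \<in> Ic"
    using colon_approximation[OF Ic, of "Var j" k] by blast
  \<comment> \<open>Vanishing on \<open>Ic\<close> will put the lift into the dual space of
    \<open>I\<close>; vanishing on \<open>order_ge n\<close> makes it a finite combination.\<close>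
  define W where "W = {a + m |a m. a \<in> Ic \<and> m \<in> order_ge n}"
  have W: "P.subspace W"
    unfolding P.subspace_def
  proof (intro conjI ballI allI)
    show "0 \<in> W"
      unfolding W_def using module.subspace_0[OF module_mult Ic] order_ge_zero
      by (intro CollectI exI[of _ 0]) simp
  next
    fix x y assume "x \<in> W" "y \<in> W"
    then obtain a m a' m' where "x = a + m" "y = a' + m'"
      "a \<in> Ic" "m \<in> order_ge n" "a' \<in> Ic" "m' \<in> order_ge n" by (auto simp: W_def)
    then show "x + y \<in> W"
      unfolding W_def using I_add[OF Ic, of a a'] order_ge_add[of m n m']
      by (intro CollectI exI[of _ "a + a'"] exI[of _ "m + m'"]) simp
  next
    fix k x assume "x \<in> W"
    then obtain a m where "x = a + m" "a \<in> Ic" "m \<in> order_ge n" by (auto simp: W_def)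
    then show "single 0 k * x \<in> W"
      unfolding W_def using I_scale[OF Ic, of a "single 0 k"] order_ge_mult_left[of m n "single 0 k"]
      by (intro CollectI exI[of _ "single 0 k * a"] exI[of _ "single 0 k * m"]) (simp add: distrib_left)
  qed
  have ker: "q p = 0" if W_p: "Var j * p \<in> W" for p
  proof -
    obtain a m where "Var j * p = a + m" "a \<in> Ic" "m \<in> order_ge n"
      using W_p by (auto simp: W_def)
    then obtain g where g: "g \<in> order_ge k" "Var j * (p - g) \<in> Ic" using n[of a p] by auto
    then have "frac (p - g) 1 \<in> colon I (coord j)"
      by (simp add: colon_def Ic_def coord_def frac_one_mult)
    then have "q (p - g) = 0" by (simp add: q_def b)
    with q_order[OF g(1)] q_add[of "p - g" g] show ?thesis by simp
  qed
  obtain \<phi> where \<phi>: "Vector_Spaces.linear ?s (*) \<phi>"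
    and \<phi>_W: "\<And>w. w \<in> W \<Longrightarrow> \<phi> w = 0" and \<phi>_T: "\<And>p. \<phi> (Var j * p) = q p"
    using linear_extend_along[OF T q W ker] by blast
  interpret \<phi>: Vector_Spaces.linear ?s "(*)" \<phi> by (rule \<phi>)
  have Ic_W: "Ic \<subseteq> W"
  proof
    fix a assume "a \<in> Ic"
    then show "a \<in> W"
      unfolding W_def using order_ge_zero by (intro CollectI exI[of _ a] exI[of _ 0]) simp
  qed
  have order_W: "order_ge n \<subseteq> W"
  proof
    fix m :: "'n mpoly" assume "m \<in> order_ge n"
    then show "m \<in> W"
      unfolding W_def using module.subspace_0[OF module_mult Ic]
      by (intro CollectI exI[of _ 0] exI[of _ m]) simp
  qed
  \<comment> \<open>The coefficients are the values of \<open>\<phi>\<close> at the monomials; those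
    of degree at least \<open>n\<close> contribute zero.\<close>
  obtain c where c: "\<And>\<alpha>. lookup c \<alpha> = (if \<alpha> \<in> {\<alpha>. index_degree \<alpha> < n} then \<phi> (single \<alpha> 1) else 0)"
    using poly_mapping_exists[OF finite_index_degree_less, of n "\<lambda>\<alpha>. \<phi> (single \<alpha> 1)"] by blast
  have \<phi>_eq: "dcomb c (frac p 1) = \<phi> p" for p
  proof (induction p rule: mpoly_induct)
    case (monom \<alpha> k)
    have "\<phi> (single \<alpha> k) = k * \<phi> (single \<alpha> 1)"
      using \<phi>.scale[of k "single \<alpha> 1"] by (simp add: mult_single)
    moreover have "\<phi> (single \<alpha> 1) = 0" if "\<not> index_degree \<alpha> < n"
      using that order_W single_in_order_ge[of n \<alpha> 1] by (intro \<phi>_W) auto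
    ultimately show ?case by (simp add: dcomb_frac_one_single c)
  next
    case (add p r)
    then show ?case by (simp add: dcomb_add \<phi>.add flip: frac_one_add)
  qed
  have "dcomb c f = 0" if "f \<in> I" for f
  proof (cases f)
    case (frac p u)
    have "frac u 1 * f = frac p 1"
      unfolding frac(1) frac_one_mult_frac[OF frac(2)]
      using frac(2) by (simp add: frac_eq_iff one_notin_origin_ideal mult.commute)
    with I_scale[OF I that, of "frac u 1"] have p: "p \<in> Ic" by (simp add: Ic_def)
    \<comment> \<open>\<open>v\<close> is the Taylor polynomial of \<open>1/u\<close> below degree
      \<open>n\<close>. As \<open>dcomb c\<close> only sees these degrees, \<open>f\<close> may be
      replaced by \<open>p * v\<close>, which lies in \<open>Ic\<close>.\<close>
    obtain v where "\<And>\<alpha>. lookup v \<alpha> =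
        (if \<alpha> \<in> {\<alpha>. index_degree \<alpha> < n} then dpoint \<alpha> (frac 1 u) else 0)"
      using poly_mapping_exists[OF finite_index_degree_less, of n "\<lambda>\<alpha>. dpoint \<alpha> (frac 1 u)"] by blast
    then have "dpoint \<alpha> (frac p 1 * frac 1 u) = dpoint \<alpha> (frac p 1 * frac v 1)"
      if "index_degree \<alpha> < n" for \<alpha>
      using that by (intro dpoint_cong_mult[of n]) (auto simp: dpoint_frac_one)
    then have "dcomb c (frac p 1 * frac 1 u) = dcomb c (frac p 1 * frac v 1)"
      unfolding dcomb_def by (intro sum.cong) (auto simp: in_keys_iff c split: if_splits)
    then have "dcomb c f = \<phi> (p * v)"
      using frac(2) by (simp add: frac(1) frac_one_mult_frac frac_one_mult \<phi>_eq)
    also have "\<dots> = 0"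
      using I_scale[OF Ic p, of v] Ic_W by (intro \<phi>_W) (auto simp: mult.commute)
    finally show ?thesis .
  qed
  moreover have "act (coord j) (dcomb c) = dcomb b"
  proof -
    obtain b' where b': "act (coord j) (dcomb c) = dcomb b'"
      using act_coord_dcomb_exists by blast
    have "lookup b' \<beta> = lookup b \<beta>" for \<beta>
    proof -
      have "dcomb b' (frac (single \<beta> 1) 1) = dcomb b (frac (single \<beta> 1) 1)"
        unfolding b'[symmetric] act_def by (simp add: coord_def frac_one_mult \<phi>_eq \<phi>_T q_def)
      then show ?thesis by (simp add: dcomb_frac_one_single)
    qed
    with b' show ?thesis by (metis poly_mapping_eqI)
  qed
  ultimately show ?thesis by blast
qed

section \<open>Order bounds and the two inclusions\<close>

lemma ord_dcomb_le_iff: "ord {j} (dcomb c) \<le> d \<longleftrightarrow> (\<forall>\<alpha>\<in>keys c. lookup \<alpha> j \<le> d)"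
  by (simp add: ord_def terms_dcomb)

text \<open>Surviving terms lose exactly one in the exponent of \<open>j\<close>; the killed ones
  have exponent zero and satisfy the bound anyway.\<close>

lemma ord_act_coord_le_iff: "ord {j} (act (coord j) (dcomb c)) \<le> d \<longleftrightarrow> ord {j} (dcomb c) \<le> d + 1"
proof -
  obtain b where b: "act (coord j) (dcomb c) = dcomb b" "\<And>\<beta>. lookup b \<beta> = lookup c (\<beta> + single j 1)"
    using act_coord_dcomb_exists by blast
  have "(\<forall>\<beta>\<in>keys b. lookup \<beta> j \<le> d) \<longleftrightarrow> (\<forall>\<alpha>\<in>keys c. lookup \<alpha> j \<le> d + 1)"
  proof (intro iffI ballI)
    fix \<alpha> assume *: "\<forall>\<beta>\<in>keys b. lookup \<beta> j \<le> d" and \<alpha>: "\<alpha> \<in> keys c"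
    show "lookup \<alpha> j \<le> d + 1"
    proof (cases "lookup \<alpha> j = 0")
      case False
      then have "\<alpha> - single j 1 + single j 1 = \<alpha>"
        using multi_index_pos_decomp[of \<alpha> j] by simp
      then have "\<alpha> - single j 1 \<in> keys b"
        using \<alpha> b(2)[of "\<alpha> - single j 1"] by (simp add: in_keys_iff)
      with * have "lookup (\<alpha> - single j 1) j \<le> d" by blast
      then show ?thesis by (simp add: lookup_minus)
    qed simp
  next
    fix \<beta> assume *: "\<forall>\<alpha>\<in>keys c. lookup \<alpha> j \<le> d + 1" and "\<beta> \<in> keys b"
    then have "\<beta> + single j 1 \<in> keys c" using b(2) by (simp add: in_keys_iff)
    with * have "lookup (\<beta> + single j 1) j \<le> d + 1" by blast
    then show "lookup \<beta> j \<le> d" by (simp add: lookup_add)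
  qed
  then show ?thesis by (simp add: b(1) ord_dcomb_le_iff)
qed

theorem proposition4p4:
  fixes I :: "'n::{finite,linorder} local_ring set" and d :: nat
  assumes "is_ideal I"
  shows "elim_dual_space d (colon I (coord first_index)) {first_index}
    = act (coord first_index) ` elim_dual_space (d + 1) I {first_index}"
proof (intro equalityI subsetI)
  let ?j = "first_index :: 'n"
  fix q assume q: "q \<in> elim_dual_space d (colon I (coord ?j)) {?j}"
  then obtain b where b: "q = dcomb b" by (auto simp: elim_dual_space_def dual_space_def D\<^sub>0_def)
  with q obtain c where c: "\<And>f. f \<in> I \<Longrightarrow> dcomb c f = 0" "act (coord ?j) (dcomb c) = q"
    using dual_coord_lift[OF assms, of ?j b] by (auto simp: elim_dual_space_def dual_space_def)
  with q have "dcomb c \<in> elim_dual_space (d + 1) I {?j}"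
    using ord_act_coord_le_iff[of ?j c d] by (auto simp: elim_dual_space_def dual_space_def D\<^sub>0_def)
  with c(2) show "q \<in> act (coord ?j) ` elim_dual_space (d + 1) I {?j}" by blast
next
  let ?j = "first_index :: 'n"
  fix q assume "q \<in> act (coord ?j) ` elim_dual_space (d + 1) I {?j}"
  then obtain c where c: "q = act (coord ?j) (dcomb c)" "dcomb c \<in> elim_dual_space (d + 1) I {?j}"
    by (auto simp: elim_dual_space_def dual_space_def D\<^sub>0_def)
  moreover have "q \<in> D\<^sub>0"
    using act_coord_dcomb_exists[of ?j c] by (auto simp: c(1) D\<^sub>0_def)
  \<comment> \<open>If \<open>f\<close> is in the colon ideal, then \<open>q f\<close> is the value
    of \<open>dcomb c\<close> at \<open>coord ?j * f\<close>, an element of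
    \<open>I\<close>.\<close>
  ultimately show "q \<in> elim_dual_space d (colon I (coord ?j)) {?j}"
    using ord_act_coord_le_iff[of ?j c d]
    by (auto simp: elim_dual_space_def dual_space_def colon_def act_def)
qed

end
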